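(* Let $p_1<p_2<\cdots$ be natural numbers $\ge 2$ such that the sequence of compact metric spaces $(\mathbb{Z}/p_n\mathbb{Z},\tilde d_{p_n})_{n\ge 1}$ converges in the Gromov-Hausdorff sense to $(\mathbb{Z}/\infty\mathbb{Z},\tilde d_\infty)$. Then the metric space $(\mathbb{Z}/\infty\mathbb{Z},\tilde d_\infty)$ is not isometric to $(\mathbb{R},|\cdot|)$, the real line with the standard metric determined by the modulus function.
   Context: For $p\in\mathbb{N}$, $p\ge 2$, each class $[n]_p\in\mathbb{Z}/p\mathbb{Z}$ has a unique representative $n_0\in[n]_p$ with $0\le n_0\le p-1$. Define $d_p([n]_p,[m]_p):=|n_0-m_0|$ and the normalized metric $\tilde d_p:=\frac{1}{p-1}d_p$. The symbol $(\mathbb{Z}/\infty\mathbb{Z},\tilde d_\infty)$ denotes the Gromov-Hausdorff limit (a compact metric space) of the given convergent sequence. *)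

theory Defs
  imports "HOL-Analysis.Analysis" "HOL-Algebra.IntRing"
begin

section \<open>Isometries\<close>

definition isometric_embedding :: "'a metric \<Rightarrow> 'b metric \<Rightarrow> ('a \<Rightarrow> 'b) \<Rightarrow> bool" where
  "isometric_embedding X Y f \<longleftrightarrow>
     f ` mspace X \<subseteq> mspace Y \<and>
     (\<forall>x\<in>mspace X. \<forall>y\<in>mspace X. mdist Y (f x) (f y) = mdist X x y)"

definition isometric :: "'a metric \<Rightarrow> 'b metric \<Rightarrow> bool" where
  "isometric X Y \<longleftrightarrow> (\<exists>f. isometric_embedding X Y f \<and> f ` mspace X = mspace Y)"


section \<open>Hausdorff and Gromov-Hausdorff distance\<close>

text \<open>The values are extended reals, so that the infimum of the empty set is infinity and
  not an arbitrary real number.\<close>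

definition hausdorff_dist :: "'a metric \<Rightarrow> 'a set \<Rightarrow> 'a set \<Rightarrow> ennreal" where
  "hausdorff_dist Z A B =
     (INF r \<in> {r. 0 < r \<and> A \<subseteq> (\<Union>b\<in>B. mball_of Z b r) \<and> B \<subseteq> (\<Union>a\<in>A. mball_of Z a r)}.
        ennreal r)"

text \<open>The infimum ranges over all metric spaces \<open>Z\<close> with isometric embeddings of \<open>X\<close> and
  \<open>Y\<close>. Only the union of the two images matters, and it injects into the sum type, so
  it suffices to let the carrier of \<open>Z\<close> be an arbitrary subset of \<open>'a + 'b\<close>; lemma
  \<open>gromov_hausdorff_dist_le\<close> below confirms that ambient spaces on other types do not give
  smaller values.\<close>

definition gromov_hausdorff_dist :: "'a metric \<Rightarrow> 'b metric \<Rightarrow> ennreal" where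
  "gromov_hausdorff_dist X Y =
     Inf {hausdorff_dist Z (f ` mspace X) (g ` mspace Y) | (Z :: ('a + 'b) metric) f g.
            isometric_embedding X Z f \<and> isometric_embedding Y Z g}"

definition gromov_hausdorff_converges :: "(nat \<Rightarrow> 'a metric) \<Rightarrow> 'b metric \<Rightarrow> bool" where
  "gromov_hausdorff_converges X L \<longleftrightarrow> (\<lambda>n. gromov_hausdorff_dist (X n) L) \<longlonglongrightarrow> 0"

lemma hausdorff_dist_image:
  assumes emb: "isometric_embedding W Z k" and A: "A \<subseteq> mspace W" and B: "B \<subseteq> mspace W"
  shows "hausdorff_dist Z (k ` A) (k ` B) = hausdorff_dist W A B"
proof -
  have *: "k ` S \<subseteq> (\<Union>b\<in>k ` T. mball_of Z b r) \<longleftrightarrow> S \<subseteq> (\<Union>b\<in>T. mball_of W b r)"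
    if "S \<subseteq> mspace W" "T \<subseteq> mspace W" for S T r
  proof -
    have "k x \<in> mball_of Z (k b) r \<longleftrightarrow> x \<in> mball_of W b r" if "x \<in> S" "b \<in> T" for x b
      using emb that \<open>S \<subseteq> mspace W\<close> \<open>T \<subseteq> mspace W\<close>
      unfolding isometric_embedding_def in_mball_of by (auto simp: image_subset_iff subset_iff)
    then show ?thesis
      unfolding image_subset_iff subset_iff[of S] UN_iff bex_simps by blast
  qed
  show ?thesis
    unfolding hausdorff_dist_def using *[OF A B] *[OF B A] by simp
qed

lemma gromov_hausdorff_dist_le:
  fixes X :: "'a metric" and Y :: "'b metric" and Z :: "'c metric"
  assumes f: "isometric_embedding X Z f" and g: "isometric_embedding Y Z g"
  shows "gromov_hausdorff_dist X Y \<le> hausdorff_dist Z (f ` mspace X) (g ` mspace Y)"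
proof -
  define k :: "'a + 'b \<Rightarrow> 'c" where "k = case_sum f g"
  define U where "U = f ` mspace X \<union> g ` mspace Y"
  define h where "h = inv_into (Inl ` mspace X \<union> Inr ` mspace Y) k"
  have U: "U = k ` (Inl ` mspace X \<union> Inr ` mspace Y)"
    by (simp add: U_def k_def image_Un image_image)
  have kh: "k (h z) = z" if "z \<in> U" for z
    using that unfolding h_def U by (rule f_inv_into_f)
  have UZ: "U \<subseteq> mspace Z"
    using f g by (auto simp: U_def isometric_embedding_def)
  interpret W: Metric_space "h ` U" "\<lambda>u v. mdist Z (k u) (k v)"
  proof
    fix u v w
    show "0 \<le> mdist Z (k u) (k v)"
      by simp
    show "mdist Z (k u) (k v) = mdist Z (k v) (k u)"
      by (simp add: mdist_commute)
    show "mdist Z (k u) (k v) = 0 \<longleftrightarrow> u = v" if "u \<in> h ` U" "v \<in> h ` U"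
      using that UZ by (auto simp: kh mdist_zero subset_iff)
    show "mdist Z (k u) (k w) \<le> mdist Z (k u) (k v) + mdist Z (k v) (k w)"
      if "u \<in> h ` U" "v \<in> h ` U" "w \<in> h ` U"
      using that UZ by (auto simp: kh subset_iff intro!: mdist_triangle)
  qed
  define W where "W = metric (h ` U, \<lambda>u v. mdist Z (k u) (k v))"
  have W: "mspace W = h ` U" "mdist W = (\<lambda>u v. mdist Z (k u) (k v))"
    by (simp_all add: W_def)
  have k: "isometric_embedding W Z k"
    using UZ by (auto simp: isometric_embedding_def W kh)
  have hf: "isometric_embedding X W (h \<circ> f)" and hg: "isometric_embedding Y W (h \<circ> g)"
    using f g by (auto simp: isometric_embedding_def W kh U_def)
  have sub: "(h \<circ> f) ` mspace X \<subseteq> mspace W" "(h \<circ> g) ` mspace Y \<subseteq> mspace W"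
    using hf hg by (auto simp: isometric_embedding_def)
  have im: "k ` (h \<circ> f) ` mspace X = f ` mspace X" "k ` (h \<circ> g) ` mspace Y = g ` mspace Y"
    unfolding image_image o_def by (auto intro!: image_cong simp: kh U_def)
  have "gromov_hausdorff_dist X Y \<le> hausdorff_dist W ((h \<circ> f) ` mspace X) ((h \<circ> g) ` mspace Y)"
    unfolding gromov_hausdorff_dist_def using hf hg by (intro Inf_lower) blast
  also have "\<dots> = hausdorff_dist Z (f ` mspace X) (g ` mspace Y)"
    using hausdorff_dist_image[OF k sub] by (simp only: im)
  finally show ?thesis .
qed


section \<open>The normalized metric on the integers modulo \<open>p\<close>\<close>

definition least_rep :: "nat \<Rightarrow> int set \<Rightarrow> int" where
  "least_rep p c = (THE k. k \<in> c \<and> 0 \<le> k \<and> k \<le> int p - 1)"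

definition Zmod_dist :: "nat \<Rightarrow> int set \<Rightarrow> int set \<Rightarrow> real" where
  "Zmod_dist p c c' = \<bar>real_of_int (least_rep p c) - real_of_int (least_rep p c')\<bar>"

definition Zmod_ndist :: "nat \<Rightarrow> int set \<Rightarrow> int set \<Rightarrow> real" where
  "Zmod_ndist p c c' = 1 / (real p - 1) * Zmod_dist p c c'"

definition Zmod_metric :: "nat \<Rightarrow> int set metric" where
  "Zmod_metric p = metric (carrier (ZFact (int p)), Zmod_ndist p)"

lemma carrier_ZFact: "carrier (ZFact k) = range (ZMod k)"
  by (auto simp: ZFact_defs A_RCOSETS_def' ZMod_def)

lemma mem_ZMod_iff: "k \<in> ZMod m a \<longleftrightarrow> k mod m = a mod m"
proof
  assume "k \<in> ZMod m a"
  then obtain x where "k = x * m + a"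
    using rcos_zfact by blast
  then show "k mod m = a mod m"
    by simp
next
  assume "k mod m = a mod m"
  then have "ZMod m a = ZMod m k"
    by (metis zmod_imp_ZMod)
  moreover have "k \<in> ZMod m k"
    unfolding ZMod_def a_r_coset_def' int_Idl by (auto intro!: exI[of _ 0])
  ultimately show "k \<in> ZMod m a"
    by simp
qed

lemma least_rep_ZMod:
  assumes "p \<ge> 2"
  shows "least_rep p (ZMod (int p) n) = n mod int p"
  unfolding least_rep_def mem_ZMod_iff
proof (rule the_equality)
  show "n mod int p mod int p = n mod int p \<and> 0 \<le> n mod int p \<and> n mod int p \<le> int p - 1"
    using assms pos_mod_bound[of "int p" n] by simp
next
  fix k assume "k mod int p = n mod int p \<and> 0 \<le> k \<and> k \<le> int p - 1"
  then show "k = n mod int p"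
    by (metis mod_pos_pos_trivial zle_diff1_eq)
qed

lemma Metric_space_Zmod:
  assumes "p \<ge> 2"
  shows "Metric_space (carrier (ZFact (int p))) (Zmod_ndist p)"
proof
  fix c c' c''
  show "0 \<le> Zmod_ndist p c c'" "Zmod_ndist p c c' = Zmod_ndist p c' c"
    using assms by (simp_all add: Zmod_ndist_def Zmod_dist_def abs_minus_commute)
  show "Zmod_ndist p c c' = 0 \<longleftrightarrow> c = c'"
    if "c \<in> carrier (ZFact (int p))" "c' \<in> carrier (ZFact (int p))"
    using that assms
    by (auto simp: carrier_ZFact Zmod_ndist_def Zmod_dist_def least_rep_ZMod mem_ZMod_iff)
  show "Zmod_ndist p c c'' \<le> Zmod_ndist p c c' + Zmod_ndist p c' c''"
    unfolding Zmod_ndist_def Zmod_dist_def distrib_left[symmetric]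
    using assms by (intro mult_left_mono) auto
qed

lemma mspace_Zmod_metric: "p \<ge> 2 \<Longrightarrow> mspace (Zmod_metric p) = carrier (ZFact (int p))"
  and mdist_Zmod_metric: "p \<ge> 2 \<Longrightarrow> mdist (Zmod_metric p) = Zmod_ndist p"
  using Metric_space_Zmod
  by (simp_all add: Zmod_metric_def Metric_space.mspace_metric Metric_space.mdist_metric)

end

theory Submission
  imports Defs
begin

text \<open>Boundedness separates the two spaces. The limit is compact, so its distances have a
  common bound by \<open>compact_space_mdist_bounded\<close>. A surjective isometry would carry this
  bound over to the real line, which contains points arbitrarily far apart.\<close>

lemma compact_space_mdist_bounded:
  assumes "compact_space (mtopology_of X)"
  obtains B where "\<And>x y. x \<in> mspace X \<Longrightarrow> y \<in> mspace X \<Longrightarrow> mdist X x y \<le> B"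
proof -
  interpret X: Metric_space "mspace X" "mdist X"
    by simp
  have "compactin X.mtopology (mspace X)"
    using assms by (simp add: compact_space_def mtopology_of_def)
  then have "X.mbounded (mspace X)"
    by (rule X.compactin_imp_mbounded)
  \<comment> \<open>\<open>mbounded\<close> asks for a closed ball containing the set;
    \<open>mbounded_alt\<close> trades it for a bound on pairwise distances.\<close>
  then show thesis
    using that unfolding X.mbounded_alt by blast
qed

theorem corollary6p3:
  fixes p :: "nat \<Rightarrow> nat" and L :: "'a metric"
  assumes "\<And>n. p n \<ge> 2"
    and "strict_mono p"
    and "compact_space (mtopology_of L)"
    and "gromov_hausdorff_converges (\<lambda>n. Zmod_metric (p n)) L"
  shows "\<not> isometric L (euclidean_metric :: real metric)"
proof
  assume "isometric L (euclidean_metric :: real metric)"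
  then obtain f :: "'a \<Rightarrow> real" where surj: "f ` mspace L = UNIV"
    and iso: "\<And>x y. x \<in> mspace L \<Longrightarrow> y \<in> mspace L \<Longrightarrow> dist (f x) (f y) = mdist L x y"
    by (auto simp: isometric_def isometric_embedding_def)
  obtain B where B: "\<And>x y. x \<in> mspace L \<Longrightarrow> y \<in> mspace L \<Longrightarrow> mdist L x y \<le> B"
    using compact_space_mdist_bounded[OF assms(3)] by blast
  have "\<exists>x\<in>mspace L. f x = r" for r
    using surj by (metis UNIV_I imageE)
  \<comment> \<open>The reals \<open>B + 1\<close> and \<open>0\<close> are more than
    \<open>B\<close> apart, whatever the sign of \<open>B\<close>, yet their preimages are at most
    \<open>B\<close> apart.\<close>
  then obtain x y where "x \<in> mspace L" "y \<in> mspace L" "f x = B + 1" "f y = 0"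
    by meson
  then have "\<bar>B + 1\<bar> \<le> B"
    using iso B by (metis diff_zero dist_real_def)
  then show False
    by simp
qed

end
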